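(* There exist an integer $k\ge1$, $\epsilon\in(0,1/2)$, an odd $n$, and an odd $r$ with $1<r<n$ such that $$\mathcal{P}_k(\mathsf{MAJ}_r;\epsilon)>\mathcal{P}_k(\mathsf{MAJ}_1;\epsilon)\quad\text{and}\quad \mathcal{P}_k(\mathsf{MAJ}_r;\epsilon)>\mathcal{P}_k(\mathsf{MAJ}_n;\epsilon).$$
   Context: For $f:\{0,1\}^n\to\{0,1\}$, $\mathcal{P}_k(f;\epsilon)=\mathbf{P}[f(y^1)=\dots=f(y^k)]$, where $x$ is uniform in $\{0,1\}^n$ and, given $x$, the events $\{y^i_j=x_j\}$ ($1\le i\le k$, $1\le j\le n$) are mutually independent, each of probability $1-\epsilon$. For odd $r\le n$, $\mathsf{MAJ}_r:\{0,1\}^n\to\{0,1\}$ is the majority of the first $r$ bits: $\mathsf{MAJ}_r(x)=1$ if $\sum_{i=1}^r x_i>r/2$ and $0$ otherwise. *)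

theory Defs
  imports "HOL-Probability.Probability" "HOL-Probability.Product_PMF"
begin

text \<open>
  Bit strings of length \<open>n\<close> are functions \<open>nat \<Rightarrow> bool\<close> (\<open>True\<close> for the bit 1) with coordinates
  \<open>1, \<dots>, n\<close>, normalised to \<open>False\<close> outside \<open>{1..n}\<close>.
\<close>

definition cube :: "nat \<Rightarrow> (nat \<Rightarrow> bool) set" where
  "cube n = PiE_dflt {1..n} False (\<lambda>_. UNIV)"

text \<open>
  The joint law of \<open>(y\<^sup>1, \<dots>, y\<^sup>k)\<close>: \<open>x\<close> is the uniform source and \<open>a (i, j)\<close> is the indicator of the
  event that bit \<open>j\<close> of \<open>y\<^sup>i\<close> agrees with bit \<open>j\<close> of \<open>x\<close>; these indicators are independent of each
  other and of \<open>x\<close>. The default \<open>True\<close> keeps every \<open>y\<^sup>i\<close> in the cube.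
\<close>

definition noisy_copies :: "nat \<Rightarrow> nat \<Rightarrow> real \<Rightarrow> (nat \<Rightarrow> nat \<Rightarrow> bool) pmf" where
  "noisy_copies n k \<epsilon> =
     bind_pmf (pmf_of_set (cube n)) (\<lambda>x.
       map_pmf (\<lambda>a i j. if a (i, j) then x j else \<not> x j)
         (Pi_pmf ({1..k} \<times> {1..n}) True (\<lambda>_. bernoulli_pmf (1 - \<epsilon>))))"

definition agreement_prob :: "nat \<Rightarrow> nat \<Rightarrow> ((nat \<Rightarrow> bool) \<Rightarrow> bool) \<Rightarrow> real \<Rightarrow> real" where
  "agreement_prob n k f \<epsilon> =
     measure_pmf.prob (noisy_copies n k \<epsilon>) {y. \<forall>i\<in>{1..k}. \<forall>i'\<in>{1..k}. f (y i) = f (y i')}"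

definition MAJ :: "nat \<Rightarrow> (nat \<Rightarrow> bool) \<Rightarrow> bool" where
  "MAJ r x \<longleftrightarrow> (\<Sum>i=1..r. of_bool (x i) :: real) > real r / 2"

end

theory Submission
  imports Defs
begin

text \<open>
  Take \<open>k = 10\<close>, \<open>\<epsilon> = 1/4\<close>, \<open>r = 3\<close> and \<open>n = 5\<close>. Conditionally on the source \<open>x\<close> the copies are
  independent, so with \<open>p x\<close> the probability that a noisy copy of \<open>x\<close> has majority 1, the agreement
  probability is the average of \<open>p x ^ k + (1 - p x) ^ k\<close> over the cube. The values of \<open>p x\<close> come
  from a recursion on the number of bits, and the three averages are rational numbers, approximately
  \<open>0.0563\<close>, \<open>0.0568\<close> and \<open>0.0558\<close> for the majorities of 1, 3 and 5 bits.
\<close>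

lemma prob_bind_pmf:
  "measure_pmf.prob (bind_pmf M N) X = measure_pmf.expectation M (\<lambda>x. measure_pmf.prob (N x) X)"
  unfolding measure_pmf_bind
  by (rule measure_pmf.measure_bind[where N = "count_space UNIV"])
     (auto simp: measure_pmf_in_subprob_algebra)

text \<open>This regroups the independent bits indexed by (copy, coordinate) into independent
  copies, so that an event imposed on every copy gets a \<open>k\<close>-th power as probability.
  Currying is injective, so it suffices to compare point masses, and both are the same double
  product.\<close>

lemma map_pmf_curry_Pi_pmf:
  assumes "finite A" "finite B"
  shows "map_pmf curry (Pi_pmf (A \<times> B) d (\<lambda>_. p)) = Pi_pmf A (\<lambda>_. d) (\<lambda>_. Pi_pmf B d (\<lambda>_. p))"
proof (rule pmf_eqI)
  fix f :: "'a \<Rightarrow> 'b \<Rightarrow> 'c"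
  have "inj (curry :: ('a \<times> 'b \<Rightarrow> 'c) \<Rightarrow> _)"
    by (metis case_prod_curry injI)
  from pmf_map_inj'[OF this, of _ "case_prod f"]
  have "pmf (map_pmf curry (Pi_pmf (A \<times> B) d (\<lambda>_. p))) f
      = pmf (Pi_pmf (A \<times> B) d (\<lambda>_. p)) (case_prod f)"
    by simp
  also have "\<dots> = (if \<forall>z. z \<notin> A \<times> B \<longrightarrow> case_prod f z = d
                   then \<Prod>i\<in>A. \<Prod>j\<in>B. pmf p (f i j) else 0)"
    unfolding pmf_Pi[OF finite_cartesian_product[OF assms]] prod.cartesian_product case_prod_unfold ..
  also have "\<dots> = pmf (Pi_pmf A (\<lambda>_. d) (\<lambda>_. Pi_pmf B d (\<lambda>_. p))) f"
  \<comment> \<open>If some row indexed by \<open>A\<close> leaves the default \<open>d\<close>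
    outside \<open>B\<close>, both masses vanish: one by its support condition, the other because
    that row contributes a zero factor.\<close>
  proof (cases "\<forall>i\<in>A. \<forall>j. j \<notin> B \<longrightarrow> f i j = d")
    case True
    then have "(\<forall>z. z \<notin> A \<times> B \<longrightarrow> case_prod f z = d) \<longleftrightarrow> (\<forall>i. i \<notin> A \<longrightarrow> f i = (\<lambda>_. d))"
      by (auto simp: fun_eq_iff)
    with True show ?thesis
      using assms by (auto simp: pmf_Pi)
  next
    case False
    then obtain i where "i \<in> A" "\<exists>j. j \<notin> B \<and> f i j \<noteq> d"
      by blast
    then have "(\<Prod>i\<in>A. pmf (Pi_pmf B d (\<lambda>_. p)) (f i)) = 0"
      using assms by (auto simp: pmf_Pi intro!: bexI[of _ i])
    moreover have "\<not> (\<forall>z. z \<notin> A \<times> B \<longrightarrow> case_prod f z = d)"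
      using False by auto
    ultimately show ?thesis
      by (simp only: pmf_Pi[OF assms(1)] if_False if_cancel)
  qed
  finally show "pmf (map_pmf curry (Pi_pmf (A \<times> B) d (\<lambda>_. p))) f
              = pmf (Pi_pmf A (\<lambda>_. d) (\<lambda>_. Pi_pmf B d (\<lambda>_. p))) f" .
qed

text \<open>Here \<open>a\<close> is the pattern of agreements with the source. Boolean equality
  copies \<open>x j\<close> where \<open>a j\<close> holds and flips it elsewhere, so
  \<open>a j = x j\<close> is the noisy bit itself.\<close>

definition noisy_prob :: "nat \<Rightarrow> real \<Rightarrow> ((nat \<Rightarrow> bool) \<Rightarrow> bool) \<Rightarrow> (nat \<Rightarrow> bool) \<Rightarrow> real" where
  "noisy_prob n \<epsilon> f x = measure_pmf.prob (Pi_pmf {1..n} True (\<lambda>_. bernoulli_pmf (1 - \<epsilon>)))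
     {a. f (\<lambda>j. a j = x j)}"

lemma finite_cube: "finite (cube n)"
  unfolding cube_def by auto

lemma card_cube: "card (cube n) = 2 ^ n"
  unfolding cube_def by (simp add: card_PiE_dflt)

lemma agreement_prob_eq:
  assumes "k \<ge> 1"
  shows "agreement_prob n k f \<epsilon> =
    (\<Sum>x\<in>cube n. noisy_prob n \<epsilon> f x ^ k + (1 - noisy_prob n \<epsilon> f x) ^ k) / 2 ^ n"
proof -
  define D where "D = Pi_pmf {1..n} True (\<lambda>_. bernoulli_pmf (1 - \<epsilon>))"
  define K where "K = Pi_pmf {1..k} (\<lambda>_. True) (\<lambda>_. D)"
  define agree where "agree = {y. \<forall>i\<in>{1..k}. \<forall>i'\<in>{1..k}. f (y i) = f (y i')}"
  have conditional: "measure_pmf.prob (map_pmf (\<lambda>a i j. if a (i, j) then x j else \<not> x j)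
         (Pi_pmf ({1..k} \<times> {1..n}) True (\<lambda>_. bernoulli_pmf (1 - \<epsilon>)))) agree
       = noisy_prob n \<epsilon> f x ^ k + (1 - noisy_prob n \<epsilon> f x) ^ k" for x
  proof -
    define S where "S = {a. f (\<lambda>j. a j = x j)}"
    have p: "measure_pmf.prob D S = noisy_prob n \<epsilon> f x"
      by (simp add: noisy_prob_def D_def S_def)
    have "map_pmf (\<lambda>a i j. if a (i, j) then x j else \<not> x j)
           (Pi_pmf ({1..k} \<times> {1..n}) True (\<lambda>_. bernoulli_pmf (1 - \<epsilon>)))
        = map_pmf (\<lambda>b i j. b i j = x j)
           (map_pmf curry (Pi_pmf ({1..k} \<times> {1..n}) True (\<lambda>_. bernoulli_pmf (1 - \<epsilon>))))"
      unfolding map_pmf_comp by (intro map_pmf_cong) (auto simp: fun_eq_iff)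
    also have "\<dots> = map_pmf (\<lambda>b i j. b i j = x j) K"
      by (simp add: map_pmf_curry_Pi_pmf K_def D_def)
    also have "measure_pmf.prob \<dots> agree
        = measure_pmf.prob K (Pi {1..k} (\<lambda>_. S) \<union> Pi {1..k} (\<lambda>_. - S))"
    proof -
      have "(\<lambda>b i j. b i j = x j) -` agree = Pi {1..k} (\<lambda>_. S) \<union> Pi {1..k} (\<lambda>_. - S)"
        unfolding agree_def S_def using assms by (fastforce simp: Pi_def)
      then show ?thesis
        by simp
    qed
    \<comment> \<open>The first event says that all values of \<open>f\<close> are 1, the second
      that all are 0. Since \<open>k \<ge> 1\<close>, copy 1 cannot satisfy both, so the events are
      disjoint.\<close>
    also have "\<dots> = measure_pmf.prob K (Pi {1..k} (\<lambda>_. S)) + measure_pmf.prob K (Pi {1..k} (\<lambda>_. - S))"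
      using assms by (intro measure_pmf.finite_measure_Union) (auto simp: Pi_def)
    also have "\<dots> = noisy_prob n \<epsilon> f x ^ k + (1 - noisy_prob n \<epsilon> f x) ^ k"
      using measure_pmf.prob_compl[of S D]
      by (simp add: K_def measure_Pi_pmf_Pi p Compl_eq_Diff_UNIV)
    finally show ?thesis .
  qed
  have "cube n \<noteq> {}"
    using card_cube[of n] by auto
  then show ?thesis
    unfolding agreement_prob_def noisy_copies_def prob_bind_pmf agree_def[symmetric] conditional
    by (simp add: integral_pmf_of_set finite_cube card_cube)
qed

text \<open>
  The probability that at least \<open>t\<close> of the first \<open>m\<close> bits of a noisy copy of \<open>x\<close> are 1. Truncation
  of \<open>t - 1\<close> at 0 is harmless, since the event is certain for \<open>t = 0\<close>.
\<close>

fun noisy_tail :: "real \<Rightarrow> (nat \<Rightarrow> bool) \<Rightarrow> nat \<Rightarrow> nat \<Rightarrow> real" where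
  "noisy_tail \<epsilon> x 0 t = of_bool (t = 0)"
| "noisy_tail \<epsilon> x (Suc m) t =
     (let q = (if x (Suc m) then 1 - \<epsilon> else \<epsilon>)
      in q * noisy_tail \<epsilon> x m (t - 1) + (1 - q) * noisy_tail \<epsilon> x m t)"

text \<open>Condition on the last agreement bit \<open>b\<close>: the last noisy bit is 1 exactly
  when \<open>b = x (Suc m)\<close>, and then the first \<open>m\<close> bits need one 1 less. The
  threshold changes along the way, hence the induction for arbitrary \<open>t\<close>.\<close>

lemma prob_ones_ge_eq_noisy_tail:
  assumes "0 \<le> \<epsilon>" "\<epsilon> \<le> 1"
  shows "measure_pmf.prob (Pi_pmf {1..m} True (\<lambda>_. bernoulli_pmf (1 - \<epsilon>)))
     {a. t \<le> (\<Sum>j=1..m. of_bool (a j = x j))} = noisy_tail \<epsilon> x m t"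
proof (induction m arbitrary: t)
  case 0
  then show ?case
    by (cases "t = 0") auto
next
  case (Suc m)
  let ?D = "\<lambda>m. Pi_pmf {1..m} True (\<lambda>_. bernoulli_pmf (1 - \<epsilon>))"
  let ?E = "\<lambda>m t. {a. t \<le> (\<Sum>j=1..m. of_bool (a j = x j))}"
  have step: "measure_pmf.prob (map_pmf (\<lambda>a. a(Suc m := b)) (?D m)) (?E (Suc m) t)
      = noisy_tail \<epsilon> x m (if b = x (Suc m) then t - 1 else t)" for b
  proof -
    have "(\<Sum>j=1..m. of_bool ((a(Suc m := b)) j = x j)) = (\<Sum>j=1..m. of_bool (a j = x j) :: nat)" for a
      by (intro sum.cong) auto
    then have "(\<Sum>j=1..Suc m. of_bool ((a(Suc m := b)) j = x j)) =
        of_bool (b = x (Suc m)) + (\<Sum>j=1..m. of_bool (a j = x j) :: nat)" for a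
      by (simp only: sum.nat_ivl_Suc' fun_upd_same)
    then have "(\<lambda>a. a(Suc m := b)) -` ?E (Suc m) t = ?E m (if b = x (Suc m) then t - 1 else t)"
      by (simp only: vimage_Collect_eq) auto
    then show ?thesis
      by (simp only: measure_map_pmf Suc.IH)
  qed
  have "{1..Suc m} = insert (Suc m) {1..m}"
    by auto
  then have "?D (Suc m) =
      bind_pmf (bernoulli_pmf (1 - \<epsilon>)) (\<lambda>b. map_pmf (\<lambda>a. a(Suc m := b)) (?D m))"
    by (simp add: Pi_pmf_insert' map_pmf_def)
  then have "measure_pmf.prob (?D (Suc m)) (?E (Suc m) t) =
      (1 - \<epsilon>) * noisy_tail \<epsilon> x m (if x (Suc m) then t - 1 else t) +
      \<epsilon> * noisy_tail \<epsilon> x m (if x (Suc m) then t else t - 1)"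
    using assms by (simp only: prob_bind_pmf step) (simp add: integral_bernoulli_pmf)
  then show ?case
    by (simp add: Let_def)
qed

lemma MAJ_odd_iff: "MAJ (2 * s + 1) x \<longleftrightarrow> s + 1 \<le> (\<Sum>i=1..2 * s + 1. of_bool (x i))"
proof -
  have "(\<Sum>i=1..2 * s + 1. of_bool (x i) :: real) = real (\<Sum>i=1..2 * s + 1. of_bool (x i))"
    by simp
  moreover have "real (2 * s + 1) / 2 < real m \<longleftrightarrow> s + 1 \<le> m" for m
    by (simp add: field_simps) linarith
  ultimately show ?thesis
    unfolding MAJ_def by (simp only:)
qed

text \<open>The majority sees only the first \<open>2 * s + 1\<close> coordinates, so the others are
  marginalised out by resetting them to the default.\<close>

lemma noisy_prob_MAJ:
  assumes "0 \<le> \<epsilon>" "\<epsilon> \<le> 1" "2 * s + 1 \<le> n"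
  shows "noisy_prob n \<epsilon> (MAJ (2 * s + 1)) x = noisy_tail \<epsilon> x (2 * s + 1) (s + 1)"
proof -
  let ?r = "2 * s + 1"
  let ?E = "{a. s + 1 \<le> (\<Sum>j=1..?r. of_bool (a j = x j))}"
  have "(\<Sum>j=1..?r. of_bool ((if j \<in> {1..?r} then a j else True) = x j)) =
      (\<Sum>j=1..?r. of_bool (a j = x j) :: nat)" for a
    by (intro sum.cong) auto
  then have "(\<lambda>a j. if j \<in> {1..?r} then a j else True) -` ?E = ?E"
    by (simp only: vimage_Collect_eq)
  moreover have "Pi_pmf {1..?r} True (\<lambda>_. bernoulli_pmf (1 - \<epsilon>)) =
      map_pmf (\<lambda>a j. if j \<in> {1..?r} then a j else True)
        (Pi_pmf {1..n} True (\<lambda>_. bernoulli_pmf (1 - \<epsilon>)))"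
    using assms by (intro Pi_pmf_subset) auto
  ultimately have "measure_pmf.prob (Pi_pmf {1..?r} True (\<lambda>_. bernoulli_pmf (1 - \<epsilon>))) ?E
      = noisy_prob n \<epsilon> (MAJ ?r) x"
    by (simp only: measure_map_pmf noisy_prob_def MAJ_odd_iff)
  then show ?thesis
    by (simp only: prob_ones_ge_eq_noisy_tail[OF assms(1,2)])
qed

lemma cube_0: "cube 0 = {\<lambda>_. False}"
  by (auto simp: cube_def PiE_dflt_def)

text \<open>Strings in \<open>cube n\<close> are False at \<open>Suc n\<close>, so
  \<open>cube n\<close> is literally the half of \<open>cube (Suc n)\<close> whose last bit is 0;
  this is why \<open>F x\<close> appears without an update.\<close>

lemma sum_cube_Suc:
  "(\<Sum>x\<in>cube (Suc n). F x) = (\<Sum>x\<in>cube n. F (x(Suc n := True)) + F x)"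
  for F :: "(nat \<Rightarrow> bool) \<Rightarrow> 'a :: comm_monoid_add"
proof -
  have outside: "x (Suc n) = False" if "x \<in> cube n" for x
    using that by (auto simp: cube_def PiE_dflt_def)
  have split: "cube (Suc n) = (\<lambda>x. x(Suc n := True)) ` cube n \<union> cube n"
  proof (intro equalityI subsetI)
    fix x assume "x \<in> cube (Suc n)"
    then have x: "x(Suc n := False) \<in> cube n"
      by (auto simp: cube_def PiE_dflt_def)
    show "x \<in> (\<lambda>x. x(Suc n := True)) ` cube n \<union> cube n"
    proof (cases "x (Suc n)")
      case True
      then have "x = (x(Suc n := False))(Suc n := True)"
        by (simp add: fun_upd_idem)
      with x show ?thesis
        by blast
    next
      case False
      then have "x(Suc n := False) = x"
        by (simp add: fun_upd_idem)
      with x show ?thesis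
        by simp
    qed
  qed (auto simp: cube_def PiE_dflt_def)
  have inj: "inj_on (\<lambda>x. x(Suc n := True)) (cube n)"
  proof (rule inj_onI)
    fix x y assume xy: "x \<in> cube n" "y \<in> cube n" and eq: "x(Suc n := True) = y(Suc n := True)"
    have "x j = y j" for j
      using fun_cong[OF eq, of j] xy[THEN outside] by (cases "j = Suc n") simp_all
    then show "x = y" ..
  qed
  have disj: "(\<lambda>x. x(Suc n := True)) ` cube n \<inter> cube n = {}"
    by (auto dest: outside)
  show ?thesis
    unfolding split
    by (simp add: sum.union_disjoint finite_cube disj sum.reindex[OF inj] sum.distrib)
qed

text \<open>Forms of the two recursions that rewrite at literals such as 5, for evaluating the sum
  over all 32 sources.\<close>

lemmas noisy_tail_numeral =
  noisy_tail.simps(2)[of _ _ "pred_numeral l" for l, folded numeral_eq_Suc]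

lemmas sum_cube_numeral = sum_cube_Suc[of _ "pred_numeral l" for l, folded numeral_eq_Suc]

theorem proposition5p2:
  "\<exists>(k::nat) (\<epsilon>::real) (n::nat) (r::nat).
     k \<ge> 1 \<and> 0 < \<epsilon> \<and> \<epsilon> < 1/2 \<and> odd n \<and> odd r \<and> 1 < r \<and> r < n \<and>
     agreement_prob n k (MAJ r) \<epsilon> > agreement_prob n k (MAJ 1) \<epsilon> \<and>
     agreement_prob n k (MAJ r) \<epsilon> > agreement_prob n k (MAJ n) \<epsilon>"
proof -
  have agreement: "agreement_prob 5 10 (MAJ (2 * s + 1)) (1/4) =
      (\<Sum>x\<in>cube 5. noisy_tail (1/4) x (2 * s + 1) (s + 1) ^ 10
        + (1 - noisy_tail (1/4) x (2 * s + 1) (s + 1)) ^ 10) / 2 ^ 5" if "s \<le> 2" for s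
    using that by (simp only: agreement_prob_eq noisy_prob_MAJ)
  \<comment> \<open>For a single bit every source gives 3/4 or 1/4, so the average is (3^10 + 1) /
    4^10. The reduced denominators for 3 and 5 bits are 2^49 and 2^89.\<close>
  have MAJ1: "agreement_prob 5 10 (MAJ 1) (1/4) = 29525 / 524288"
    using agreement[of 0] by (simp add: noisy_tail_numeral sum_cube_numeral sum_cube_Suc cube_0 power_divide)
  have MAJ3: "agreement_prob 5 10 (MAJ 3) (1/4) = 32001074633585 / 562949953421312"
    using agreement[of 1] by (simp add: noisy_tail_numeral sum_cube_numeral sum_cube_Suc cube_0 power_divide)
  have MAJ5: "agreement_prob 5 10 (MAJ 5) (1/4) = 34555538179449576306677705 / 618970019642690137449562112"
    using agreement[of 2] by (simp add: noisy_tail_numeral sum_cube_numeral sum_cube_Suc cube_0 power_divide)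
  show ?thesis
    \<comment> \<open>Keeping \<open>One_nat_def\<close> out of the simplification preserves
      \<open>MAJ 1\<close> in the goal, so that the equation \<open>MAJ1\<close> still
      matches.\<close>
    by (rule exI[of _ 10], rule exI[of _ "1/4"], rule exI[of _ 5], rule exI[of _ 3])
       (simp add: MAJ1 MAJ3 MAJ5 del: One_nat_def)
qed

end
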